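(* Let $A$ be an integral domain, $K$ its quotient field and $E$ a nonzero $A$-submodule of $K$ such that $E^2\subseteq E$. Then the following statements are equivalent: (1) $A\bowtie E$ is an Hermite ring. (2) $A\bowtie E$ is a Bézout ring. (3) $A$ is a Bézout ring and $A\subseteq E$.
   Context: All rings are commutative with identity. The condition $E^2\subseteq E$ means that $E$ is closed under the multiplication of $K$; then $A+E$ is a subring of $K$ and $E$ is an ideal of $A+E$. The amalgamated duplication of $A$ along $E$ is the subring $A\bowtie E=\{(a,a+e) : a\in A,\ e\in E\}$ of $A\times(A+E)$. A ring is a Bézout ring if every finitely generated ideal is principal (zero divisors are allowed). A ring $R$ is an Hermite ring if for every matrix $M$ over $R$ there exists a non-singular (i.e. invertible over $R$) square matrix $Q$ over $R$ such that $MQ$ is a triangular matrix; equivalently (a known characterization), for all $a,b\in R$ there exist $a_1,b_1,d\in R$ such that $a=a_1d$, $b=b_1d$ and $Ra_1+Rb_1=R$. *)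

theory Defs
  imports "HOL-Algebra.Algebra"
begin

definition quotient_field_of :: "'a set \<Rightarrow> ('a, 'm) ring_scheme \<Rightarrow> bool"
  where "quotient_field_of A K \<longleftrightarrow>
    field K \<and> subdomain A K \<and>
    (\<forall>x \<in> carrier K. \<exists>a \<in> A. \<exists>b \<in> A - {\<zero>\<^bsub>K\<^esub>}. x = a \<otimes>\<^bsub>K\<^esub> inv\<^bsub>K\<^esub> b)"

text \<open>The ring \<open>K\<close> as a module, with scalars acting by the multiplication of \<open>K\<close>. The ring of
  scalars is chosen in \<^const>\<open>submodule\<close>, which takes it as a separate parameter.\<close>

definition self_module :: "('a, 'm) ring_scheme \<Rightarrow> ('a, 'a) module"
  where "self_module K =
    \<lparr> carrier = carrier K, monoid.mult = monoid.mult K, one = one K, ring.zero = ring.zero K, add = add K,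
      smult = monoid.mult K \<rparr>"

text \<open>The subring \<open>{(a, a + e). a \<in> A, e \<in> E}\<close> of \<open>A \<times> (A + E)\<close>.\<close>

definition amalgamated_duplication :: "('a, 'm) ring_scheme \<Rightarrow> 'a set \<Rightarrow> 'a set \<Rightarrow> ('a \<times> 'a) ring"
  where "amalgamated_duplication K A E =
    (RDirProd (K\<lparr>carrier := A\<rparr>) (K\<lparr>carrier := A <+>\<^bsub>K\<^esub> E\<rparr>))
      \<lparr>carrier := {(a, a \<oplus>\<^bsub>K\<^esub> e) | a e. a \<in> A \<and> e \<in> E}\<rparr>"

locale bezout_ring = cring R for R (structure) +
  assumes finitely_generated_principal:
    "\<lbrakk> S \<subseteq> carrier R; finite S \<rbrakk> \<Longrightarrow> principalideal (Idl S) R"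

text \<open>An \<open>m \<times> n\<close> matrix over \<open>R\<close> is a function of a row and a column index, counted from 0; only
  the entries \<open>M i j\<close> with \<open>i < m\<close> and \<open>j < n\<close> matter.\<close>

definition is_matrix :: "('a, 'm) ring_scheme \<Rightarrow> nat \<Rightarrow> nat \<Rightarrow> (nat \<Rightarrow> nat \<Rightarrow> 'a) \<Rightarrow> bool"
  where "is_matrix R m n M \<longleftrightarrow> (\<forall>i < m. \<forall>j < n. M i j \<in> carrier R)"

text \<open>The product of an \<open>m \<times> n\<close> matrix with an \<open>n \<times> k\<close> matrix, \<open>n\<close> being the second argument.\<close>

definition matrix_mult ::
    "('a, 'm) ring_scheme \<Rightarrow> nat \<Rightarrow> (nat \<Rightarrow> nat \<Rightarrow> 'a) \<Rightarrow> (nat \<Rightarrow> nat \<Rightarrow> 'a) \<Rightarrow> nat \<Rightarrow> nat \<Rightarrow> 'a"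
  where "matrix_mult R n M N = (\<lambda>i j. \<Oplus>\<^bsub>R\<^esub>k \<in> {..<n}. M i k \<otimes>\<^bsub>R\<^esub> N k j)"

definition is_identity_matrix :: "('a, 'm) ring_scheme \<Rightarrow> nat \<Rightarrow> (nat \<Rightarrow> nat \<Rightarrow> 'a) \<Rightarrow> bool"
  where "is_identity_matrix R n M \<longleftrightarrow>
    (\<forall>i < n. \<forall>j < n. M i j = (if i = j then \<one>\<^bsub>R\<^esub> else \<zero>\<^bsub>R\<^esub>))"

definition invertible_matrix :: "('a, 'm) ring_scheme \<Rightarrow> nat \<Rightarrow> (nat \<Rightarrow> nat \<Rightarrow> 'a) \<Rightarrow> bool"
  where "invertible_matrix R n Q \<longleftrightarrow> is_matrix R n n Q \<and>
    (\<exists>P. is_matrix R n n P \<and> is_identity_matrix R n (matrix_mult R n Q P) \<and>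
         is_identity_matrix R n (matrix_mult R n P Q))"

text \<open>For rectangular matrices reduced by column operations, triangular means lower triangular: all
  entries above the main diagonal vanish. (Upper triangularity would be no condition on a single row.)\<close>

definition triangular_matrix ::
    "('a, 'm) ring_scheme \<Rightarrow> nat \<Rightarrow> nat \<Rightarrow> (nat \<Rightarrow> nat \<Rightarrow> 'a) \<Rightarrow> bool"
  where "triangular_matrix R m n M \<longleftrightarrow> (\<forall>i < m. \<forall>j < n. i < j \<longrightarrow> M i j = \<zero>\<^bsub>R\<^esub>)"

locale hermite_ring = cring R for R (structure) +
  assumes triangular_reduction:
    "is_matrix R m n M \<Longrightarrow>
      \<exists>Q. invertible_matrix R n Q \<and> triangular_matrix R m n (matrix_mult R n M Q)"

end

theory Submission
  imports Defs
begin

text \<open>For a nonzero \<open>a \<in> A \<inter> E\<close>, principality of the ideal of \<open>A \<bowtie> E\<close> generated by \<open>(a, 0)\<close> and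
  \<open>(0, a)\<close> forces \<open>1 \<in> E\<close>, and \<open>A\<close> is a quotient of \<open>A \<bowtie> E\<close>. Conversely, if \<open>A \<subseteq> E\<close> then
  \<open>A \<bowtie> E = A \<times> E\<close>, where \<open>E\<close> is an overring of the Bezout domain \<open>A\<close>. Any two elements of \<open>A\<close>, and
  after clearing denominators any two elements of \<open>E\<close>, can be written as \<open>a' d\<close> and \<open>b' d\<close> with \<open>a'\<close>,
  \<open>b'\<close> comaximal; the same then holds componentwise in \<open>A \<times> E\<close>, and this property lets column
  operations clear the entries above the diagonal of a matrix one at a time.\<close>

section \<open>Matrices over a ring\<close>

lemma (in abelian_monoid) finsum_swap:
  assumes "finite A" "finite B" "\<And>i j. i \<in> A \<Longrightarrow> j \<in> B \<Longrightarrow> f i j \<in> carrier G"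
  shows "(\<Oplus>i\<in>A. \<Oplus>j\<in>B. f i j) = (\<Oplus>j\<in>B. \<Oplus>i\<in>A. f i j)"
  using assms(1,3)
proof (induction A rule: finite_induct)
  case empty
  then show ?case by simp
next
  case (insert a A)
  have "(\<Oplus>i\<in>insert a A. \<Oplus>j\<in>B. f i j) = (\<Oplus>j\<in>B. f a j) \<oplus> (\<Oplus>i\<in>A. \<Oplus>j\<in>B. f i j)"
    using insert by (intro finsum_insert) (auto intro!: finsum_closed)
  also have "\<dots> = (\<Oplus>j\<in>B. f a j) \<oplus> (\<Oplus>j\<in>B. \<Oplus>i\<in>A. f i j)"
    using insert by simp
  also have "\<dots> = (\<Oplus>j\<in>B. f a j \<oplus> (\<Oplus>i\<in>A. f i j))"
    using insert by (intro finsum_addf [symmetric]) (auto intro!: finsum_closed)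
  also have "\<dots> = (\<Oplus>j\<in>B. \<Oplus>i\<in>insert a A. f i j)"
    using insert by (intro finsum_cong' refl) (auto intro!: finsum_closed finsum_insert [symmetric])
  finally show ?case .
qed

context ring
begin

lemma matrix_mult_closed:
  assumes "\<And>k. k < n \<Longrightarrow> M i k \<in> carrier R" "\<And>k. k < n \<Longrightarrow> N k j \<in> carrier R"
  shows "matrix_mult R n M N i j \<in> carrier R"
  using assms unfolding matrix_mult_def by (intro finsum_closed) auto

lemma is_matrix_mult:
  assumes "is_matrix R m n M" "is_matrix R n k N"
  shows "is_matrix R m k (matrix_mult R n M N)"
  using assms unfolding is_matrix_def by (auto intro!: matrix_mult_closed)

text \<open>Matrices are functions with arbitrary values outside their index range, so identities
  between products are handled one entry at a time instead of as equations of functions.\<close>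

lemma matrix_mult_cong:
  assumes "\<And>k. k < n \<Longrightarrow> M i k = M' i k" "\<And>k. k < n \<Longrightarrow> N k j = N' k j"
    and "\<And>k. k < n \<Longrightarrow> M' i k \<in> carrier R" "\<And>k. k < n \<Longrightarrow> N' k j \<in> carrier R"
  shows "matrix_mult R n M N i j = matrix_mult R n M' N' i j"
  using assms unfolding matrix_mult_def by (intro finsum_cong' refl) auto

lemma matrix_mult_assoc:
  assumes "\<And>k. k < n \<Longrightarrow> M i k \<in> carrier R" "is_matrix R n l N"
    and "\<And>k. k < l \<Longrightarrow> P k j \<in> carrier R"
  shows "matrix_mult R l (matrix_mult R n M N) P i j = matrix_mult R n M (matrix_mult R l N P) i j"
proof -
  have N: "\<And>k h. k < n \<Longrightarrow> h < l \<Longrightarrow> N k h \<in> carrier R"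
    using assms(2) unfolding is_matrix_def by blast
  have "matrix_mult R l (matrix_mult R n M N) P i j
      = (\<Oplus>h\<in>{..<l}. \<Oplus>k\<in>{..<n}. M i k \<otimes> N k h \<otimes> P h j)"
    unfolding matrix_mult_def using assms N
    by (intro finsum_cong' refl) (auto intro!: finsum_closed finsum_ldistr)
  also have "\<dots> = (\<Oplus>k\<in>{..<n}. \<Oplus>h\<in>{..<l}. M i k \<otimes> N k h \<otimes> P h j)"
    using assms N by (intro finsum_swap) auto
  also have "\<dots> = (\<Oplus>k\<in>{..<n}. \<Oplus>h\<in>{..<l}. M i k \<otimes> (N k h \<otimes> P h j))"
    using assms N by (intro finsum_cong' refl) (auto intro!: finsum_closed simp: m_assoc)
  also have "\<dots> = matrix_mult R n M (matrix_mult R l N P) i j"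
    unfolding matrix_mult_def using assms N
    by (intro finsum_cong' refl) (auto intro!: finsum_closed finsum_rdistr [symmetric])
  finally show ?thesis .
qed

lemma matrix_mult_identity:
  assumes "\<And>k. k < n \<Longrightarrow> M i k \<in> carrier R" "is_identity_matrix R n I" "j < n"
  shows "matrix_mult R n M I i j = M i j"
proof -
  have "matrix_mult R n M I i j = (\<Oplus>k\<in>{..<n}. if j = k then M i k else \<zero>)"
    unfolding matrix_mult_def using assms
    by (intro finsum_cong' refl) (auto simp: is_identity_matrix_def)
  also have "\<dots> = M i j"
    using assms by (intro finsum_singleton) auto
  finally show ?thesis .
qed

text \<open>\<open>(QG)(HP) = (Q(GH))P = QP\<close>. The lemma treats one side only; with the roles
  of the matrices exchanged it also gives the product in the other order, as two-sided inverses
  require.\<close>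

lemma is_identity_matrix_cancel:
  assumes "is_matrix R n n Q" "is_matrix R n n G" "is_matrix R n n P" "is_matrix R n n H"
    and QP: "is_identity_matrix R n (matrix_mult R n Q P)"
    and GH: "is_identity_matrix R n (matrix_mult R n G H)"
  shows "is_identity_matrix R n (matrix_mult R n (matrix_mult R n Q G) (matrix_mult R n H P))"
proof -
  have "matrix_mult R n (matrix_mult R n Q G) (matrix_mult R n H P) i j = matrix_mult R n Q P i j"
    if ij: "i < n" "j < n" for i j
  proof -
    have HP: "is_matrix R n n (matrix_mult R n H P)" and QG: "is_matrix R n n (matrix_mult R n Q G)"
      using assms is_matrix_mult by blast+
    have "matrix_mult R n (matrix_mult R n Q G) (matrix_mult R n H P) i j
        = matrix_mult R n (matrix_mult R n (matrix_mult R n Q G) H) P i j"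
      using assms ij QG by (intro matrix_mult_assoc [symmetric]) (auto simp: is_matrix_def)
    also have "\<dots> = matrix_mult R n Q P i j"
    proof (rule matrix_mult_cong)
      fix k assume k: "k < n"
      have "matrix_mult R n (matrix_mult R n Q G) H i k = matrix_mult R n Q (matrix_mult R n G H) i k"
        using assms ij k by (intro matrix_mult_assoc) (auto simp: is_matrix_def)
      also have "\<dots> = Q i k"
        using assms ij k by (intro matrix_mult_identity) (auto simp: is_matrix_def)
      finally show "matrix_mult R n (matrix_mult R n Q G) H i k = Q i k" .
    qed (use assms ij in \<open>auto simp: is_matrix_def\<close>)
    finally show ?thesis .
  qed
  then show ?thesis
    using QP by (simp add: is_identity_matrix_def)
qed

lemma invertible_matrix_mult:
  assumes "invertible_matrix R n Q" "invertible_matrix R n G"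
  shows "invertible_matrix R n (matrix_mult R n Q G)"
proof -
  obtain P H where P: "is_matrix R n n P" "is_identity_matrix R n (matrix_mult R n Q P)"
      "is_identity_matrix R n (matrix_mult R n P Q)"
    and H: "is_matrix R n n H" "is_identity_matrix R n (matrix_mult R n G H)"
      "is_identity_matrix R n (matrix_mult R n H G)"
    using assms unfolding invertible_matrix_def by blast
  have "is_matrix R n n Q" "is_matrix R n n G"
    using assms unfolding invertible_matrix_def by auto
  then show ?thesis
    unfolding invertible_matrix_def
    using P H is_identity_matrix_cancel is_matrix_mult
    by (intro conjI exI [of _ "matrix_mult R n H P"]) blast+
qed

end

section \<open>Column operations\<close>

text \<open>Right multiplication by this matrix multiplies the pair of columns \<open>(p, q)\<close> by the
  \<open>2 \<times> 2\<close> matrix with rows \<open>(\<alpha>, \<beta>)\<close> and \<open>(\<gamma>, \<delta>)\<close>.\<close>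

definition column_mix ::
    "('a, 'm) ring_scheme \<Rightarrow> nat \<Rightarrow> nat \<Rightarrow> 'a \<Rightarrow> 'a \<Rightarrow> 'a \<Rightarrow> 'a \<Rightarrow> nat \<Rightarrow> nat \<Rightarrow> 'a"
  where "column_mix R p q \<alpha> \<beta> \<gamma> \<delta> = (\<lambda>i j.
    if j = p then (if i = p then \<alpha> else if i = q then \<gamma> else \<zero>\<^bsub>R\<^esub>)
    else if j = q then (if i = p then \<beta> else if i = q then \<delta> else \<zero>\<^bsub>R\<^esub>)
    else if i = j then \<one>\<^bsub>R\<^esub> else \<zero>\<^bsub>R\<^esub>)"

context ring
begin

lemma is_matrix_column_mix:
  "\<lbrakk> \<alpha> \<in> carrier R; \<beta> \<in> carrier R; \<gamma> \<in> carrier R; \<delta> \<in> carrier R \<rbrakk>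
    \<Longrightarrow> is_matrix R m n (column_mix R p q \<alpha> \<beta> \<gamma> \<delta>)"
  by (simp add: is_matrix_def column_mix_def)

lemma finsum_two_terms:
  assumes "p < n" "q < n" "p \<noteq> q" "f p \<in> carrier R" "f q \<in> carrier R"
    and "\<And>k. k < n \<Longrightarrow> k \<noteq> p \<Longrightarrow> k \<noteq> q \<Longrightarrow> f k = \<zero>"
  shows "(\<Oplus>k\<in>{..<n::nat}. f k) = f p \<oplus> f q"
proof -
  have "f k \<in> carrier R" if "k < n" for k
    using assms that by (metis zero_closed)
  then have "(\<Oplus>k\<in>{..<n}. f k) = (\<Oplus>k\<in>{p, q}. f k)"
    using assms by (intro add.finprod_mono_neutral_cong_right) auto
  then show ?thesis
    using assms by simp
qed

lemma matrix_mult_column_mix: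
  assumes "p < n" "q < n" "p \<noteq> q" "j < n" "\<And>k. k < n \<Longrightarrow> M i k \<in> carrier R"
    and "\<alpha> \<in> carrier R" "\<beta> \<in> carrier R" "\<gamma> \<in> carrier R" "\<delta> \<in> carrier R"
  shows "matrix_mult R n M (column_mix R p q \<alpha> \<beta> \<gamma> \<delta>) i j =
    (if j = p then M i p \<otimes> \<alpha> \<oplus> M i q \<otimes> \<gamma>
     else if j = q then M i p \<otimes> \<beta> \<oplus> M i q \<otimes> \<delta> else M i j)"
proof (cases "j = p \<or> j = q")
  case True
  then have "matrix_mult R n M (column_mix R p q \<alpha> \<beta> \<gamma> \<delta>) i j =
      M i p \<otimes> column_mix R p q \<alpha> \<beta> \<gamma> \<delta> p j \<oplus> M i q \<otimes> column_mix R p q \<alpha> \<beta> \<gamma> \<delta> q j"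
    unfolding matrix_mult_def using assms
    by (intro finsum_two_terms) (auto simp: column_mix_def)
  then show ?thesis
    using True assms by (auto simp: column_mix_def)
next
  case False
  then have "matrix_mult R n M (column_mix R p q \<alpha> \<beta> \<gamma> \<delta>) i j = (\<Oplus>k\<in>{..<n}. if j = k then M i k else \<zero>)"
    unfolding matrix_mult_def using assms
    by (intro finsum_cong' refl) (auto simp: column_mix_def)
  also have "\<dots> = M i j"
    using assms by (intro finsum_singleton) auto
  finally show ?thesis
    using False by simp
qed

end

context cring
begin

text \<open>The second factor carries the adjugate of the 2 by 2 block of the first, which is its
  inverse because the determinant is 1.\<close>

lemma is_identity_column_mix_mult:
  assumes "p < n" "q < n" "p \<noteq> q"
    and "\<alpha> \<in> carrier R" "\<beta> \<in> carrier R" "\<gamma> \<in> carrier R" "\<delta> \<in> carrier R"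
    and det: "\<alpha> \<otimes> \<delta> \<ominus> \<beta> \<otimes> \<gamma> = \<one>"
  shows "is_identity_matrix R n
    (matrix_mult R n (column_mix R p q \<alpha> \<beta> \<gamma> \<delta>) (column_mix R p q \<delta> (\<ominus> \<beta>) (\<ominus> \<gamma>) \<alpha>))"
proof -
  have "\<alpha> \<otimes> \<delta> \<oplus> \<beta> \<otimes> \<ominus> \<gamma> = \<alpha> \<otimes> \<delta> \<ominus> \<beta> \<otimes> \<gamma>"
    "\<gamma> \<otimes> \<ominus> \<beta> \<oplus> \<delta> \<otimes> \<alpha> = \<alpha> \<otimes> \<delta> \<ominus> \<beta> \<otimes> \<gamma>"
    "\<alpha> \<otimes> \<ominus> \<beta> \<oplus> \<beta> \<otimes> \<alpha> = \<zero>" "\<gamma> \<otimes> \<delta> \<oplus> \<delta> \<otimes> \<ominus> \<gamma> = \<zero>"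
    using assms(4-7) by algebra+
  moreover have "is_matrix R n n (column_mix R p q \<alpha> \<beta> \<gamma> \<delta>)"
    using assms by (intro is_matrix_column_mix)
  ultimately show ?thesis
    unfolding is_identity_matrix_def det
    by (auto simp: matrix_mult_column_mix is_matrix_def assms) (auto simp: column_mix_def assms assms(3) [symmetric])
qed

lemma invertible_column_mix:
  assumes "p < n" "q < n" "p \<noteq> q"
    and "\<alpha> \<in> carrier R" "\<beta> \<in> carrier R" "\<gamma> \<in> carrier R" "\<delta> \<in> carrier R"
    and "\<alpha> \<otimes> \<delta> \<ominus> \<beta> \<otimes> \<gamma> = \<one>"
  shows "invertible_matrix R n (column_mix R p q \<alpha> \<beta> \<gamma> \<delta>)"
proof -
  \<comment> \<open>The adjugate again has determinant 1 and its own adjugate is the original block,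
    so the one-sided lemma also yields the product in the reverse order.\<close>
  have "\<delta> \<otimes> \<alpha> \<ominus> \<ominus> \<beta> \<otimes> \<ominus> \<gamma> = \<one>"
    using assms(4-8) by (simp add: l_minus r_minus m_comm)
  then have "is_identity_matrix R n
      (matrix_mult R n (column_mix R p q \<delta> (\<ominus> \<beta>) (\<ominus> \<gamma>) \<alpha>) (column_mix R p q \<alpha> \<beta> \<gamma> \<delta>))"
    using is_identity_column_mix_mult [of p n q \<delta> "\<ominus> \<beta>" "\<ominus> \<gamma>" \<alpha>] assms by simp
  then show ?thesis
    unfolding invertible_matrix_def using assms
    by (intro conjI exI [of _ "column_mix R p q \<delta> (\<ominus> \<beta>) (\<ominus> \<gamma>) \<alpha>"])
      (auto intro: is_matrix_column_mix is_identity_column_mix_mult)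
qed

lemma invertible_identity_matrix: "\<exists>I. invertible_matrix R n I \<and> is_identity_matrix R n I"
proof -
  define I where "I = (\<lambda>i j::nat. if i = j then \<one> else \<zero>)"
  have I: "is_matrix R n n I" "is_identity_matrix R n I"
    by (auto simp: I_def is_matrix_def is_identity_matrix_def)
  then have "matrix_mult R n I I i j = I i j" if "i < n" "j < n" for i j
    using that by (intro matrix_mult_identity) (auto simp: is_matrix_def)
  with I have "is_identity_matrix R n (matrix_mult R n I I)"
    by (simp add: is_identity_matrix_def)
  with I show ?thesis
    unfolding invertible_matrix_def by blast
qed

end

section \<open>Hermite rings\<close>

text \<open>The elementwise criterion for Hermite rings, with comaximality of the two cofactors
  spelled out as a relation \<open>u a' + v b' = 1\<close>. Its coefficients supply the entries of
  the column operations.\<close>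

locale unimodular_factorization = cring R for R (structure) +
  assumes unimodular_factors: "\<lbrakk> a \<in> carrier R; b \<in> carrier R \<rbrakk> \<Longrightarrow>
    \<exists>a' \<in> carrier R. \<exists>b' \<in> carrier R. \<exists>d \<in> carrier R. \<exists>u \<in> carrier R. \<exists>v \<in> carrier R.
      a = a' \<otimes> d \<and> b = b' \<otimes> d \<and> u \<otimes> a' \<oplus> v \<otimes> b' = \<one>"

context unimodular_factorization
begin

text \<open>Entries above the diagonal are cleared in row-major order, and position
  \<open>(r, c)\<close> is next. Mixing the columns \<open>r\<close> and \<open>c\<close> does no
  damage: rows above \<open>r\<close> already vanish in both columns, and row \<open>r\<close>
  changes in these two columns only.\<close>

lemma clear_entry:
  assumes M: "is_matrix R m n M" and r: "r < m" "r < c" "c < n"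
    and zero: "\<And>i j. \<lbrakk> i < m; j < n; i < j; i < r \<or> i = r \<and> j < c \<rbrakk> \<Longrightarrow> M i j = \<zero>"
  shows "\<exists>G. invertible_matrix R n G \<and> (\<forall>i < m. \<forall>j < n. i < j \<longrightarrow>
    i < r \<or> i = r \<and> j < Suc c \<longrightarrow> matrix_mult R n M G i j = \<zero>)"
proof -
  have entry: "\<And>i j. i < m \<Longrightarrow> j < n \<Longrightarrow> M i j \<in> carrier R"
    using M unfolding is_matrix_def by blast
  have "r < n"
    using r by simp
  then obtain a b d u v where carr: "a \<in> carrier R" "b \<in> carrier R" "d \<in> carrier R"
      "u \<in> carrier R" "v \<in> carrier R"
    and Mr: "M r r = a \<otimes> d" "M r c = b \<otimes> d" and uv: "u \<otimes> a \<oplus> v \<otimes> b = \<one>"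
    using unimodular_factors [OF entry [OF r(1) \<open>r < n\<close>] entry [OF r(1,3)]] by blast
  \<comment> \<open>The block with rows \<open>(u, -b)\<close> and \<open>(v, a)\<close> has
    determinant \<open>u a + v b = 1\<close>, and its second column sends the row
    \<open>(a d, b d)\<close> to \<open>- a d b + b d a = 0\<close>.\<close>
  define G where "G = column_mix R r c u (\<ominus> b) v a"
  have "u \<otimes> a \<ominus> \<ominus> b \<otimes> v = \<one>"
    using carr uv by (simp add: l_minus r_minus minus_eq m_comm)
  then have "invertible_matrix R n G"
    unfolding G_def using r carr by (intro invertible_column_mix) auto
  moreover have "matrix_mult R n M G i j = \<zero>"
    if ij: "i < m" "j < n" "i < j" "i < r \<or> i = r \<and> j < Suc c" for i j
  proof -
    have eq: "matrix_mult R n M G i j =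
        (if j = r then M i r \<otimes> u \<oplus> M i c \<otimes> v
         else if j = c then M i r \<otimes> (\<ominus> b) \<oplus> M i c \<otimes> a else M i j)"
      unfolding G_def using r carr ij entry by (intro matrix_mult_column_mix) auto
    show ?thesis
    proof (cases "i < r")
      case True
      then have "M i r = \<zero>" "M i c = \<zero>" "M i j = \<zero>"
        using zero r ij by simp_all
      then show ?thesis
        using carr by (simp add: eq)
    next
      case False
      then have "i = r" using ij by auto
      show ?thesis
      proof (cases "j = c")
        case True
        have "a \<otimes> d \<otimes> \<ominus> b \<oplus> b \<otimes> d \<otimes> a = \<zero>"
          using carr(1-3) by algebra
        then show ?thesis
          unfolding eq using True \<open>i = r\<close> r by (simp add: Mr)
      next
        case False
        then have "M i j = \<zero>"
          using zero ij \<open>i = r\<close> by simp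
        then show ?thesis
          unfolding eq using False ij \<open>i = r\<close> by simp
      qed
    qed
  qed
  ultimately show ?thesis by blast
qed

text \<open>The condition on \<open>i\<close> and \<open>j\<close> says that the position precedes
  \<open>(r, c)\<close> in row-major order. The induction is nested: \<open>extend\<close> moves
  \<open>c\<close> along a fixed row, and the outer induction moves \<open>r\<close> down the
  rows.\<close>

lemma partial_triangular_reduction:
  assumes M: "is_matrix R m n M"
  shows "\<exists>Q. invertible_matrix R n Q \<and> (\<forall>i < m. \<forall>j < n. i < j \<longrightarrow>
    i < r \<or> i = r \<and> j < c \<longrightarrow> matrix_mult R n M Q i j = \<zero>)"
proof -
  have extend: "\<exists>Q. invertible_matrix R n Q \<and> (\<forall>i < m. \<forall>j < n. i < j \<longrightarrow>
      i < r \<or> i = r \<and> j < c \<longrightarrow> matrix_mult R n M Q i j = \<zero>)"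
    if start: "\<exists>Q. invertible_matrix R n Q \<and> (\<forall>i < m. \<forall>j < n. i < j \<longrightarrow>
      i < r \<longrightarrow> matrix_mult R n M Q i j = \<zero>)" for r c
  proof (induction c)
    case 0
    then show ?case using start by simp
  next
    case (Suc c)
    then obtain Q where Q: "invertible_matrix R n Q"
      and zero: "\<And>i j. \<lbrakk> i < m; j < n; i < j; i < r \<or> i = r \<and> j < c \<rbrakk> \<Longrightarrow> matrix_mult R n M Q i j = \<zero>"
      by blast
    show ?case
    \<comment> \<open>Otherwise \<open>(r, c)\<close> lies outside the matrix or not above the
      diagonal, and the old \<open>Q\<close> still serves.\<close>
    proof (cases "r < m \<and> r < c \<and> c < n")
      case True
      have "is_matrix R n n Q"
        using Q unfolding invertible_matrix_def by blast
      then obtain G where G: "invertible_matrix R n G"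
        and G_zero: "\<forall>i < m. \<forall>j < n. i < j \<longrightarrow> i < r \<or> i = r \<and> j < Suc c \<longrightarrow>
          matrix_mult R n (matrix_mult R n M Q) G i j = \<zero>"
        using clear_entry [OF is_matrix_mult [OF M] _ _ _ zero] True by blast
      have "matrix_mult R n (matrix_mult R n M Q) G i j = matrix_mult R n M (matrix_mult R n Q G) i j"
        if "i < m" "j < n" for i j
        using M Q G that by (intro matrix_mult_assoc) (auto simp: invertible_matrix_def is_matrix_def)
      then show ?thesis
        using G_zero invertible_matrix_mult [OF Q G] by (metis (no_types, lifting))
    next
      case False
      then show ?thesis
        using Q zero by (intro exI [of _ Q]) (auto simp: less_Suc_eq)
    qed
  qed
  show ?thesis
  proof (induction r arbitrary: c)
    case 0
    \<comment> \<open>No row lies above row 0, so any invertible matrix can start the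
      process.\<close>
    show ?case using extend [of 0] invertible_identity_matrix by blast
  next
    case (Suc r)
    \<comment> \<open>The induction hypothesis at \<open>c = n\<close> covers all of row
      \<open>r\<close>, which is the starting condition for row \<open>Suc r\<close>.\<close>
    have "\<exists>Q. invertible_matrix R n Q \<and> (\<forall>i < m. \<forall>j < n. i < j \<longrightarrow>
        i < Suc r \<longrightarrow> matrix_mult R n M Q i j = \<zero>)"
      using Suc [of n] by (auto simp: less_Suc_eq)
    then show ?case by (rule extend)
  qed
qed

lemma hermite_ring: "hermite_ring R"
proof
  fix m n M assume "is_matrix R m n M"
  \<comment> \<open>With \<open>r = m\<close> every row index satisfies \<open>i < r\<close>, so the
    value of \<open>c\<close> is immaterial.\<close>
  from partial_triangular_reduction [OF this, of m 0]
  obtain Q where "invertible_matrix R n Q" "triangular_matrix R m n (matrix_mult R n M Q)"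
    unfolding triangular_matrix_def by metis
  then show "\<exists>Q. invertible_matrix R n Q \<and> triangular_matrix R m n (matrix_mult R n M Q)"
    by blast
qed

end

section \<open>Bezout rings\<close>

context cring
begin

lemma ideal_lincomb:
  assumes "ideal I R" "u \<in> carrier R" "v \<in> carrier R" "a \<in> I" "b \<in> I"
  shows "u \<otimes> a \<oplus> v \<otimes> b \<in> I"
proof -
  interpret ideal I R by fact
  show ?thesis using assms by (simp add: I_l_closed)
qed

text \<open>Two generators at a time suffice: by induction on the generating set, a new element and
  a generator of the ideal of the others merge into one. The condition on pairs is purely
  equational, so it can be checked componentwise and passes through ring homomorphisms.\<close>

lemma bezout_ringI:
  assumes pair: "\<And>a b. \<lbrakk> a \<in> carrier R; b \<in> carrier R \<rbrakk> \<Longrightarrow>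
    \<exists>a' \<in> carrier R. \<exists>b' \<in> carrier R. \<exists>u \<in> carrier R. \<exists>v \<in> carrier R. \<exists>d \<in> carrier R.
      a = a' \<otimes> d \<and> b = b' \<otimes> d \<and> d = u \<otimes> a \<oplus> v \<otimes> b"
  shows "bezout_ring R"
proof (intro bezout_ring.intro bezout_ring_axioms.intro cring_axioms)
  fix S assume S: "S \<subseteq> carrier R" "finite S"
  have "\<exists>d \<in> carrier R. Idl S = PIdl d"
    using S(2,1)
  proof (induction S rule: finite_induct)
    case empty
    have "\<zero> \<in> Idl {}"
      by (intro additive_subgroup.zero_closed ideal.axioms(1) genideal_ideal) simp
    then have "Idl {} = PIdl \<zero>"
      using genideal_minimal [OF zeroideal, of "{}"] cgenideal_eq_genideal [OF zero_closed] genideal_zero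
      by auto
    then show ?case by blast
  next
    case (insert s S)
    then obtain c where c: "c \<in> carrier R" "Idl S = PIdl c" and s: "s \<in> carrier R"
      and S: "S \<subseteq> carrier R" by auto
    obtain s' c' u v d where d: "s' \<in> carrier R" "c' \<in> carrier R" "u \<in> carrier R" "v \<in> carrier R"
        "d \<in> carrier R" "s = s' \<otimes> d" "c = c' \<otimes> d" "d = u \<otimes> s \<oplus> v \<otimes> c"
      using pair [OF s c(1)] by (elim bexE conjE)
    have ideal_d: "ideal (PIdl d) R" and ideal_S: "ideal (Idl (insert s S)) R"
      using d(5) s S by (auto intro: cgenideal_ideal genideal_ideal)
    have "s \<in> PIdl d" "c \<in> PIdl d"
      unfolding cgenideal_def using d(1,2,6,7) by blast+
    moreover have "S \<subseteq> PIdl c"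
      using c S genideal_self by blast
    ultimately have "Idl (insert s S) \<subseteq> PIdl d"
      using ideal_d cgenideal_minimal [of "PIdl d" c] by (intro genideal_minimal) auto
    moreover have "s \<in> Idl (insert s S)"
      using s S genideal_self [of "insert s S"] by auto
    moreover have "Idl S \<subseteq> Idl (insert s S)"
      using ideal_S s S genideal_self [of "insert s S"] by (intro genideal_minimal) auto
    then have "c \<in> Idl (insert s S)"
      using c cgenideal_self by blast
    ultimately have "d \<in> Idl (insert s S)"
      using ideal_lincomb [OF ideal_S d(3,4)] d(8) by metis
    then have "PIdl d \<subseteq> Idl (insert s S)"
      using ideal_S cgenideal_minimal by blast
    with \<open>Idl (insert s S) \<subseteq> PIdl d\<close> d(5) show ?case by blast
  qed
  then show "principalideal (Idl S) R"
    using cgenideal_is_principalideal by metis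
qed

end

lemma (in bezout_ring) pair_generator:
  assumes a: "a \<in> carrier R" and b: "b \<in> carrier R"
  obtains a' b' u v d where "a' \<in> carrier R" "b' \<in> carrier R" "u \<in> carrier R" "v \<in> carrier R"
    "d \<in> carrier R" "a = a' \<otimes> d" "b = b' \<otimes> d" "d = u \<otimes> a \<oplus> v \<otimes> b"
proof -
  obtain d where d: "d \<in> carrier R" "Idl {a, b} = PIdl d"
    using finitely_generated_principal [of "{a, b}"] a b cgenideal_eq_genideal
      principalideal.generate by fastforce
  have "a \<in> PIdl d" "b \<in> PIdl d"
    using d a b genideal_self [of "{a, b}"] by auto
  then obtain a' b' where ab': "a' \<in> carrier R" "b' \<in> carrier R" "a = a' \<otimes> d" "b = b' \<otimes> d"
    unfolding cgenideal_def by blast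
  \<comment> \<open>The sum of the two principal ideals contains \<open>a\<close> and
    \<open>b\<close>, hence also \<open>d\<close>; this exhibits \<open>d\<close> as a linear
    combination.\<close>
  have "Idl {a, b} \<subseteq> (PIdl a) <+> (PIdl b)"
  proof (rule genideal_minimal)
    show "ideal ((PIdl a) <+> (PIdl b)) R"
      using a b by (intro add_ideals cgenideal_ideal)
    have "\<zero> \<in> PIdl a" "\<zero> \<in> PIdl b"
      using a b cgenideal_ideal additive_subgroup.zero_closed ideal.axioms(1) by blast+
    then have "a \<oplus> \<zero> \<in> (PIdl a) <+> (PIdl b)" "\<zero> \<oplus> b \<in> (PIdl a) <+> (PIdl b)"
      using a b cgenideal_self unfolding set_add_def' by blast+
    then show "{a, b} \<subseteq> (PIdl a) <+> (PIdl b)"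
      using a b by simp
  qed
  then have "d \<in> (PIdl a) <+> (PIdl b)"
    using d cgenideal_self by blast
  then obtain u v where "u \<in> carrier R" "v \<in> carrier R" "d = u \<otimes> a \<oplus> v \<otimes> b"
    unfolding cgenideal_def set_add_def' by blast
  with ab' d(1) show ?thesis by (intro that)
qed

text \<open>Reducing the row \<open>(a, b)\<close> by an invertible \<open>Q\<close> gives
  \<open>(d, 0)\<close>. The first column of \<open>Q\<close> expresses \<open>d\<close> through
  \<open>a\<close> and \<open>b\<close>, and the first row of the inverse of \<open>Q\<close>
  expresses \<open>a\<close> and \<open>b\<close> as multiples of \<open>d\<close>.\<close>

lemma hermite_imp_bezout:
  fixes R (structure)
  assumes "hermite_ring R"
  shows "bezout_ring R"
proof -
  interpret hermite_ring R by fact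
  show ?thesis
  proof (rule bezout_ringI)
    fix a b assume ab: "a \<in> carrier R" "b \<in> carrier R"
    define M where "M = (\<lambda>(i::nat) (j::nat). if j = 0 then a else b)"
    have M: "is_matrix R 1 2 M"
      using ab by (auto simp: M_def is_matrix_def)
    then obtain Q P where Q: "is_matrix R 2 2 Q" and P: "is_matrix R 2 2 P"
      and tri: "triangular_matrix R 1 2 (matrix_mult R 2 M Q)"
      and QP: "is_identity_matrix R 2 (matrix_mult R 2 Q P)"
      using triangular_reduction unfolding invertible_matrix_def by blast
    define d where "d = matrix_mult R 2 M Q 0 0"
    have two: "{..<2::nat} = {0, 1}" by auto
    have carr: "\<And>i j. i < 2 \<Longrightarrow> j < 2 \<Longrightarrow> Q i j \<in> carrier R" "\<And>i j. i < 2 \<Longrightarrow> j < 2 \<Longrightarrow> P i j \<in> carrier R"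
      using P Q unfolding is_matrix_def by auto
    have d: "d = Q 0 0 \<otimes> a \<oplus> Q 1 0 \<otimes> b"
      using ab carr by (simp add: d_def matrix_mult_def two M_def m_comm)
    then have d_carr: "d \<in> carrier R"
      using ab carr by simp
    have "M 0 j = P 0 j \<otimes> d" if j: "j < 2" for j
    proof -
      \<comment> \<open>Undo the reduction: \<open>M = M(QP) = (MQ)P\<close>, where
        \<open>MQ\<close> is the row \<open>(d, 0)\<close>.\<close>
      have "M 0 j = matrix_mult R 2 M (matrix_mult R 2 Q P) 0 j"
        using M QP j by (intro matrix_mult_identity [symmetric]) (auto simp: is_matrix_def)
      also have "\<dots> = matrix_mult R 2 (matrix_mult R 2 M Q) P 0 j"
        using M Q P j by (intro matrix_mult_assoc [symmetric]) (auto simp: is_matrix_def)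
      also have "\<dots> = d \<otimes> P 0 j \<oplus> matrix_mult R 2 M Q 0 1 \<otimes> P 1 j"
        using ab carr d_carr j is_matrix_mult [OF M Q]
        unfolding d_def by (subst (1) matrix_mult_def) (simp add: two is_matrix_def)
      also have "matrix_mult R 2 M Q 0 1 = \<zero>"
        using tri by (simp add: triangular_matrix_def)
      finally show ?thesis
        using d_carr carr j by (simp add: m_comm)
    qed
    from this [of 0] this [of 1] have "a = P 0 0 \<otimes> d" "b = P 0 1 \<otimes> d"
      by (simp_all add: M_def)
    moreover have "P 0 0 \<in> carrier R" "P 0 1 \<in> carrier R" "Q 0 0 \<in> carrier R" "Q 1 0 \<in> carrier R"
      using carr by simp_all
    ultimately show "\<exists>a' \<in> carrier R. \<exists>b' \<in> carrier R. \<exists>u \<in> carrier R. \<exists>v \<in> carrier R.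
        \<exists>d \<in> carrier R. a = a' \<otimes> d \<and> b = b' \<otimes> d \<and> d = u \<otimes> a \<oplus> v \<otimes> b"
      using d d_carr by blast
  qed
qed

text \<open>Substituting \<open>a = a' d\<close> and \<open>b = b' d\<close> into
  \<open>d = u a + v b\<close> gives \<open>(u a' + v b') d = d\<close>, and a nonzero
  \<open>d\<close> cancels in a domain.\<close>

lemma bezout_domain_unimodular_factorization:
  fixes R (structure)
  assumes "domain R" "bezout_ring R"
  shows "unimodular_factorization R"
proof -
  interpret domain R by fact
  interpret bezout_ring R by fact
  show ?thesis
  proof
    fix a b assume ab: "a \<in> carrier R" "b \<in> carrier R"
    obtain a' b' u v d where *: "a' \<in> carrier R" "b' \<in> carrier R" "u \<in> carrier R" "v \<in> carrier R"
        "d \<in> carrier R" "a = a' \<otimes> d" "b = b' \<otimes> d" "d = u \<otimes> a \<oplus> v \<otimes> b"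
      using pair_generator [OF ab] .
    show "\<exists>a' \<in> carrier R. \<exists>b' \<in> carrier R. \<exists>d \<in> carrier R. \<exists>u \<in> carrier R. \<exists>v \<in> carrier R.
        a = a' \<otimes> d \<and> b = b' \<otimes> d \<and> u \<otimes> a' \<oplus> v \<otimes> b' = \<one>"
    proof (cases "d = \<zero>")
      case True
      \<comment> \<open>Here \<open>a = b = 0\<close> and the cofactors found above need not be
        comaximal, so they are replaced by 1 and 0.\<close>
      then have "a = \<one> \<otimes> \<zero>" "b = \<zero> \<otimes> \<zero>" "\<one> \<otimes> \<one> \<oplus> \<zero> \<otimes> \<zero> = \<one>"
        using *(1,2,6,7) by simp_all
      then show ?thesis by blast
    next
      case False
      have "(u \<otimes> a' \<oplus> v \<otimes> b') \<otimes> d = u \<otimes> (a' \<otimes> d) \<oplus> v \<otimes> (b' \<otimes> d)"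
        using *(1-5) by (simp add: l_distr m_assoc)
      also have "\<dots> = \<one> \<otimes> d"
        using *(5-8) by (metis l_one)
      finally have "u \<otimes> a' \<oplus> v \<otimes> b' = \<one>"
        using m_rcancel [OF False *(5)] *(1-4) by (metis a_closed m_closed one_closed)
      with *(1-7) show ?thesis by blast
    qed
  qed
qed

section \<open>Amalgamated duplications\<close>

locale duplication_data =
  fixes K :: "('a, 'm) ring_scheme" (structure) and A E :: "'a set"
  assumes quotient_field: "quotient_field_of A K"
    and submodule_E: "submodule E (K\<lparr>carrier := A\<rparr>) (self_module K)"
    and E_nonzero: "E \<noteq> {\<zero>}"
    and E_mult: "\<lbrakk> x \<in> E; y \<in> E \<rbrakk> \<Longrightarrow> x \<otimes> y \<in> E"

sublocale duplication_data \<subseteq> field K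
  using quotient_field unfolding quotient_field_of_def by blast

context duplication_data
begin

abbreviation "dup \<equiv> amalgamated_duplication K A E"

lemma A_subdomain: "subdomain A K"
  using quotient_field unfolding quotient_field_of_def by blast

lemmas A_subring = subcring.axioms(1) [OF subdomain.axioms(1) [OF A_subdomain]]

lemma A_sub: "a \<in> A \<Longrightarrow> a \<in> carrier K"
  using subringE(1) [OF A_subring] by auto

lemma fraction:
  assumes "x \<in> carrier K"
  obtains a b where "a \<in> A" "b \<in> A" "b \<noteq> \<zero>" "x = a \<otimes> inv b"
  using assms quotient_field unfolding quotient_field_of_def by blast

lemma E_subgroup: "subgroup E (add_monoid K)"
proof -
  interpret E: submodule E "K\<lparr>carrier := A\<rparr>" "self_module K" by (fact submodule_E)
  \<comment> \<open>Additive inverses depend only on the carrier, addition and zero, which the two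
    records share.\<close>
  have "inv\<^bsub>add_monoid (self_module K)\<^esub> x = inv\<^bsub>add_monoid K\<^esub> x" for x
    by (simp add: m_inv_def self_module_def)
  then show ?thesis
    using E.subset E.m_closed E.one_closed E.m_inv_closed
    by (intro subgroup.intro) (simp_all add: self_module_def)
qed

lemma E_sub: "x \<in> E \<Longrightarrow> x \<in> carrier K"
  using subgroup.subset [OF E_subgroup] by auto

lemma E_add: "x \<in> E \<Longrightarrow> y \<in> E \<Longrightarrow> x \<oplus> y \<in> E"
  using subgroup.m_closed [OF E_subgroup] by simp

lemma E_zero: "\<zero> \<in> E"
  using subgroup.one_closed [OF E_subgroup] by simp

lemma E_neg: "x \<in> E \<Longrightarrow> \<ominus> x \<in> E"
  using subgroup.m_inv_closed [OF E_subgroup] by (simp add: a_inv_def)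

lemma E_smult: "a \<in> A \<Longrightarrow> x \<in> E \<Longrightarrow> a \<otimes> x \<in> E"
  using submodule.smult_closed [OF submodule_E] by (simp add: self_module_def)

lemma A_add: "x \<in> A \<Longrightarrow> y \<in> A \<Longrightarrow> x \<oplus> y \<in> A"
  using subringE(7) [OF A_subring] by blast

lemma A_mult: "x \<in> A \<Longrightarrow> y \<in> A \<Longrightarrow> x \<otimes> y \<in> A"
  using subringE(6) [OF A_subring] by blast

lemma A_one: "\<one> \<in> A"
  using subringE(3) [OF A_subring] by blast

lemma A_neg: "x \<in> A \<Longrightarrow> \<ominus> x \<in> A"
  using subringE(5) [OF A_subring] by blast

lemma A_zero: "\<zero> \<in> A"
  using subringE(2) [OF A_subring] by blast

section \<open>The duplication as a commutative ring\<close>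

lemma dup_simps [simp]:
  "carrier dup = {(a, a \<oplus> e) | a e. a \<in> A \<and> e \<in> E}"
  "monoid.mult dup x y = (fst x \<otimes> fst y, snd x \<otimes> snd y)"
  "add dup x y = (fst x \<oplus> fst y, snd x \<oplus> snd y)"
  "one dup = (\<one>, \<one>)"
  "ring.zero dup = (\<zero>, \<zero>)"
  by (simp_all add: amalgamated_duplication_def RDirProd_def DirProd_def monoid.defs case_prod_unfold)

text \<open>Trades the existential description of the carrier for a condition on the difference of
  the components, so that closure proofs become identities between differences. The rule
  \<open>dup_simps(1)\<close> is switched off wherever this form is wanted.\<close>

lemma in_dup_iff:
  "(a, x) \<in> carrier dup \<longleftrightarrow> a \<in> A \<and> x \<in> carrier K \<and> x \<ominus> a \<in> E"
proof -
  have "x = a \<oplus> (x \<ominus> a)" if "a \<in> carrier K" "x \<in> carrier K" for x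
    using that by algebra
  moreover have "a \<oplus> e \<ominus> a = e" if "a \<in> carrier K" "e \<in> carrier K" for e
    using that by algebra
  ultimately show ?thesis
    using A_sub E_sub by auto
qed

lemma dup_mult_closed:
  assumes "(a, x) \<in> carrier dup" "(b, y) \<in> carrier dup"
  shows "(a \<otimes> b, x \<otimes> y) \<in> carrier dup"
proof -
  have *: "a \<in> A" "b \<in> A" "x \<in> carrier K" "y \<in> carrier K" "x \<ominus> a \<in> E" "y \<ominus> b \<in> E"
    using assms by (simp_all add: in_dup_iff del: dup_simps(1))
  \<comment> \<open>With \<open>x = a + e\<close> and \<open>y = b + f\<close> the difference is
    \<open>a f + b e + e f\<close>; the last term is where closure of \<open>E\<close> under
    multiplication enters.\<close>
  have "x \<otimes> y \<ominus> a \<otimes> b = a \<otimes> (y \<ominus> b) \<oplus> b \<otimes> (x \<ominus> a) \<oplus> (x \<ominus> a) \<otimes> (y \<ominus> b)"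
    using *(3,4) A_sub [OF *(1)] A_sub [OF *(2)] by algebra
  also have "\<dots> \<in> E"
    using * by (intro E_add E_smult E_mult)
  finally show ?thesis
    using * A_mult by (simp add: in_dup_iff del: dup_simps(1))
qed

lemma dup_add_closed:
  assumes "(a, x) \<in> carrier dup" "(b, y) \<in> carrier dup"
  shows "(a \<oplus> b, x \<oplus> y) \<in> carrier dup"
proof -
  have *: "a \<in> A" "b \<in> A" "x \<in> carrier K" "y \<in> carrier K" "x \<ominus> a \<in> E" "y \<ominus> b \<in> E"
    using assms by (simp_all add: in_dup_iff del: dup_simps(1))
  have "x \<oplus> y \<ominus> (a \<oplus> b) = (x \<ominus> a) \<oplus> (y \<ominus> b)"
    using *(3,4) A_sub [OF *(1)] A_sub [OF *(2)] by algebra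
  then show ?thesis
    using * A_add E_add by (simp add: in_dup_iff del: dup_simps(1))
qed

lemma dup_neg_closed:
  assumes "(a, x) \<in> carrier dup"
  shows "(\<ominus> a, \<ominus> x) \<in> carrier dup"
proof -
  have *: "a \<in> A" "x \<in> carrier K" "x \<ominus> a \<in> E"
    using assms by (simp_all add: in_dup_iff del: dup_simps(1))
  have "\<ominus> x \<ominus> \<ominus> a = \<ominus> (x \<ominus> a)"
    using *(2) A_sub [OF *(1)] by algebra
  then show ?thesis
    using * A_neg E_neg by (simp add: in_dup_iff del: dup_simps(1))
qed

lemma dup_diagonal: "a \<in> A \<Longrightarrow> (a, a) \<in> carrier dup"
  using A_sub E_zero by (simp add: in_dup_iff minus_eq r_neg del: dup_simps(1))

text \<open>The ring laws hold componentwise in \<open>K\<close>, so only closure depends on the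
  shape of the pairs.\<close>

lemma dup_cring: "cring dup"
proof -
  have sub: "fst r \<in> carrier K" "snd r \<in> carrier K" if "r \<in> carrier dup" for r
    using that A_sub in_dup_iff [of "fst r" "snd r"] by (simp_all del: dup_simps(1))
  show ?thesis
  proof (intro cringI abelian_groupI comm_monoidI)
    fix r assume r: "r \<in> carrier dup"
    show "\<exists>s \<in> carrier dup. s \<oplus>\<^bsub>dup\<^esub> r = \<zero>\<^bsub>dup\<^esub>"
      using r sub [OF r] dup_neg_closed [of "fst r" "snd r"]
      by (intro bexI [of _ "(\<ominus> fst r, \<ominus> snd r)"]) (simp_all add: l_neg del: dup_simps(1))
  next
    fix r s assume "r \<in> carrier dup" "s \<in> carrier dup"
    then show "r \<oplus>\<^bsub>dup\<^esub> s \<in> carrier dup" "r \<otimes>\<^bsub>dup\<^esub> s \<in> carrier dup"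
      using dup_add_closed [of "fst r" "snd r" "fst s" "snd s"]
        dup_mult_closed [of "fst r" "snd r" "fst s" "snd s"] by (simp_all del: dup_simps(1))
  qed (use dup_diagonal A_zero A_one sub in
      \<open>simp_all add: a_ac m_ac l_distr r_distr del: dup_simps(1)\<close>)
qed

section \<open>Consequences of the duplication being a Bezout ring\<close>

lemma A_domain: "domain (K\<lparr>carrier := A\<rparr>)"
  using subdomain_is_domain A_subdomain by blast

text \<open>Clearing the denominator of a nonzero element of \<open>E\<close> stays in
  \<open>E\<close>, by scalar multiplication, and lands in \<open>A\<close>.\<close>

lemma E_meets_A: "\<exists>a \<in> A. a \<in> E \<and> a \<noteq> \<zero>"
proof -
  obtain e where e: "e \<in> E" "e \<noteq> \<zero>"
    using E_nonzero E_zero by blast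
  obtain a b where ab: "a \<in> A" "b \<in> A" "b \<noteq> \<zero>" "e = a \<otimes> inv b"
    using fraction [OF E_sub [OF e(1)]] .
  have "b \<otimes> e = a"
    using ab A_sub field_Units by (simp add: m_lcomm)
  moreover have "a \<noteq> \<zero>"
    using ab e A_sub field_Units by auto
  ultimately show ?thesis
    using E_smult [OF ab(2) e(1)] ab(1) by auto
qed

text \<open>The first projection is a ring homomorphism onto \<open>A\<close>, and the diagonal
  lifts elements of \<open>A\<close>; the equations for a generator of two diagonal pairs project to
  equations in \<open>A\<close>.\<close>

lemma bezout_dup_imp_bezout:
  assumes "bezout_ring dup"
  shows "bezout_ring (K\<lparr>carrier := A\<rparr>)" (is "bezout_ring ?A")
proof (rule cring.bezout_ringI)
  show "cring ?A"
    using A_domain domain.axioms(1) by blast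
  fix a b assume "a \<in> carrier ?A" "b \<in> carrier ?A"
  then have mem: "(a, a) \<in> carrier dup" "(b, b) \<in> carrier dup"
    using dup_diagonal by simp_all
  obtain p q u v d where *: "p \<in> carrier dup" "q \<in> carrier dup" "u \<in> carrier dup"
      "v \<in> carrier dup" "d \<in> carrier dup" "(a, a) = p \<otimes>\<^bsub>dup\<^esub> d" "(b, b) = q \<otimes>\<^bsub>dup\<^esub> d"
      "d = u \<otimes>\<^bsub>dup\<^esub> (a, a) \<oplus>\<^bsub>dup\<^esub> v \<otimes>\<^bsub>dup\<^esub> (b, b)"
    using bezout_ring.pair_generator [OF assms mem] .
  have "a = fst p \<otimes> fst d" "b = fst q \<otimes> fst d"
    using *(6,7) by simp_all
  moreover have "fst d = fst u \<otimes> a \<oplus> fst v \<otimes> b"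
    by (subst *(8)) simp
  moreover have "fst p \<in> A" "fst q \<in> A" "fst u \<in> A" "fst v \<in> A" "fst d \<in> A"
    using *(1-5) by auto
  ultimately have "\<exists>a' \<in> A. \<exists>b' \<in> A. \<exists>u \<in> A. \<exists>v \<in> A. \<exists>d \<in> A.
      a = a' \<otimes> d \<and> b = b' \<otimes> d \<and> d = u \<otimes> a \<oplus> v \<otimes> b"
    by blast
  then show "\<exists>a' \<in> carrier ?A. \<exists>b' \<in> carrier ?A. \<exists>u \<in> carrier ?A. \<exists>v \<in> carrier ?A. \<exists>d \<in> carrier ?A.
      a = a' \<otimes>\<^bsub>?A\<^esub> d \<and> b = b' \<otimes>\<^bsub>?A\<^esub> d \<and> d = u \<otimes>\<^bsub>?A\<^esub> a \<oplus>\<^bsub>?A\<^esub> v \<otimes>\<^bsub>?A\<^esub> b"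
    by simp
qed

lemma bezout_dup_imp_subset:
  assumes "bezout_ring dup"
  shows "A \<subseteq> E"
proof -
  \<comment> \<open>If \<open>d\<close> generates the ideal of \<open>(a, 0)\<close> and \<open>(0, a)\<close> and \<open>(a, 0) = r d\<close>, the second component of
    \<open>r\<close> vanishes, so the first lies in \<open>E\<close>; it is also a unit of \<open>A\<close>.\<close>
  obtain a where a: "a \<in> A" "a \<in> E" "a \<noteq> \<zero>"
    using E_meets_A by blast
  \<comment> \<open>The two differences are \<open>-a\<close> and \<open>a\<close>, which is why
    \<open>a\<close> has to lie in \<open>E\<close> as well as in \<open>A\<close>.\<close>
  have mem: "(a, \<zero>) \<in> carrier dup" "(\<zero>, a) \<in> carrier dup"
    using a A_sub A_zero E_neg by (simp_all add: in_dup_iff minus_eq del: dup_simps(1))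
  obtain r s p q d where *: "r \<in> carrier dup" "s \<in> carrier dup" "p \<in> carrier dup" "q \<in> carrier dup"
      "d \<in> carrier dup" "(a, \<zero>) = r \<otimes>\<^bsub>dup\<^esub> d" "(\<zero>, a) = s \<otimes>\<^bsub>dup\<^esub> d"
      "d = p \<otimes>\<^bsub>dup\<^esub> (a, \<zero>) \<oplus>\<^bsub>dup\<^esub> q \<otimes>\<^bsub>dup\<^esub> (\<zero>, a)"
    using bezout_ring.pair_generator [OF assms mem] .
  obtain r1 r2 s1 s2 p1 p2 q1 q2 d1 d2 where pairs: "r = (r1, r2)" "s = (s1, s2)" "p = (p1, p2)"
      "q = (q1, q2)" "d = (d1, d2)"
    by fastforce
  have carr: "r1 \<in> A" "r2 \<in> carrier K" "r2 \<ominus> r1 \<in> E" "p1 \<in> A" "q1 \<in> A" "d2 \<in> carrier K"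
    "s2 \<in> carrier K"
    using * by (simp_all add: pairs in_dup_iff del: dup_simps(1))
  have eqs: "a = r1 \<otimes> d1" "r2 \<otimes> d2 = \<zero>" "a = s2 \<otimes> d2"
    using *(6,7) by (simp_all add: pairs)
  have "d1 = p1 \<otimes> a \<oplus> q1 \<otimes> \<zero>"
    using *(8) by (simp add: pairs)
  then have d1: "d1 = p1 \<otimes> a"
    using carr a A_sub by simp
  have "d2 \<noteq> \<zero>"
    using eqs(3) a(3) carr r_null by metis
  then have "r2 = \<zero>"
    using eqs(2) carr integral by metis
  then have "\<ominus> r1 \<in> E"
    using carr A_sub by (simp add: minus_eq)
  then have "r1 \<in> E"
    using E_neg A_sub carr minus_minus by metis
  \<comment> \<open>Combining \<open>a = r1 d1\<close> with \<open>d1 = p1 a\<close> and cancelling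
    \<open>a\<close> shows that \<open>r1\<close> is a unit of \<open>A\<close>; as
    \<open>r1\<close> lies in \<open>E\<close>, so does 1.\<close>
  have "(p1 \<otimes> r1) \<otimes> a = \<one> \<otimes> a"
    using eqs(1) d1 carr a A_sub by (metis l_one m_assoc m_comm)
  then have "p1 \<otimes> r1 = \<one>"
    using carr a A_sub by (metis m_closed m_rcancel one_closed)
  then have "\<one> \<in> E"
    using E_smult \<open>r1 \<in> E\<close> carr by metis
  show ?thesis
  proof
    fix x assume "x \<in> A"
    then show "x \<in> E"
      using E_smult [OF _ \<open>\<one> \<in> E\<close>] A_sub by force
  qed
qed

section \<open>From a Bezout domain inside \<open>E\<close> to a Hermite duplication\<close>

lemma unimodular_factors_in_A:
  assumes "bezout_ring (K\<lparr>carrier := A\<rparr>)" "a \<in> A" "b \<in> A"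
  obtains a' b' d u v where "a' \<in> A" "b' \<in> A" "d \<in> A" "u \<in> A" "v \<in> A"
    "a = a' \<otimes> d" "b = b' \<otimes> d" "u \<otimes> a' \<oplus> v \<otimes> b' = \<one>"
proof -
  interpret A: unimodular_factorization "K\<lparr>carrier := A\<rparr>"
    by (rule bezout_domain_unimodular_factorization [OF A_domain assms(1)])
  have "a \<in> carrier (K\<lparr>carrier := A\<rparr>)" "b \<in> carrier (K\<lparr>carrier := A\<rparr>)"
    using assms by simp_all
  from A.unimodular_factors [OF this] show ?thesis
    by (elim bexE conjE) (rule that, simp_all)
qed

text \<open>Over the common denominator \<open>s t\<close> the numerators are \<open>a t\<close> and
  \<open>b s\<close>. Factoring these in \<open>A\<close> gives comaximal cofactors that serve
  unchanged in \<open>E\<close>; only the common factor has to be divided by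
  \<open>s t\<close>.\<close>

lemma overring_unimodular_factors:
  assumes "bezout_ring (K\<lparr>carrier := A\<rparr>)" "A \<subseteq> E" "x \<in> E" "y \<in> E"
  shows "\<exists>x' \<in> E. \<exists>y' \<in> E. \<exists>d \<in> E. \<exists>u \<in> E. \<exists>v \<in> E.
    x = x' \<otimes> d \<and> y = y' \<otimes> d \<and> u \<otimes> x' \<oplus> v \<otimes> y' = \<one>"
proof -
  obtain a s where as: "a \<in> A" "s \<in> A" "s \<noteq> \<zero>" "x = a \<otimes> inv s"
    using fraction [OF E_sub [OF assms(3)]] .
  obtain b t where bt: "b \<in> A" "t \<in> A" "t \<noteq> \<zero>" "y = b \<otimes> inv t"
    using fraction [OF E_sub [OF assms(4)]] .
  have inv_carr: "inv s \<in> carrier K" "inv t \<in> carrier K" "s \<otimes> inv s = \<one>" "t \<otimes> inv t = \<one>"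
    using as bt A_sub field_Units by auto
  note carr = inv_carr(1,2) A_sub [OF as(1)] A_sub [OF as(2)] A_sub [OF bt(1)] A_sub [OF bt(2)]
  obtain a' b' d u v where *: "a' \<in> A" "b' \<in> A" "d \<in> A" "u \<in> A" "v \<in> A"
      "a \<otimes> t = a' \<otimes> d" "b \<otimes> s = b' \<otimes> d" "u \<otimes> a' \<oplus> v \<otimes> b' = \<one>"
    using unimodular_factors_in_A [OF assms(1) A_mult [OF as(1) bt(2)] A_mult [OF bt(1) as(2)]] .
  define f where "f = d \<otimes> (inv s \<otimes> inv t)"
  have carr': "a' \<in> carrier K" "b' \<in> carrier K" "d \<in> carrier K" "u \<in> carrier K" "v \<in> carrier K"
      "f \<in> carrier K"
    using * carr A_sub by (auto simp: f_def)
  have "(a \<otimes> t) \<otimes> (inv s \<otimes> inv t) = (a \<otimes> inv s) \<otimes> (t \<otimes> inv t)"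
    using carr by algebra
  then have "x = (a \<otimes> t) \<otimes> (inv s \<otimes> inv t)"
    using as(4) inv_carr(4) carr by simp
  then have x: "x = a' \<otimes> f"
    using *(6) carr carr' by (simp add: f_def m_assoc)
  have "(b \<otimes> s) \<otimes> (inv s \<otimes> inv t) = (b \<otimes> inv t) \<otimes> (s \<otimes> inv s)"
    using carr by algebra
  then have "y = (b \<otimes> s) \<otimes> (inv s \<otimes> inv t)"
    using bt(4) inv_carr(3) carr by simp
  then have y: "y = b' \<otimes> f"
    using *(7) carr carr' by (simp add: f_def m_assoc)
  \<comment> \<open>Being a fraction, \<open>f\<close> is not visibly in \<open>E\<close>.
    Multiplying the comaximality relation by \<open>f\<close> writes it as an
    \<open>A\<close>-linear combination of \<open>x\<close> and \<open>y\<close>.\<close>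
  have "u \<otimes> x \<oplus> v \<otimes> y = (u \<otimes> a' \<oplus> v \<otimes> b') \<otimes> f"
    unfolding x y using carr' by algebra
  then have "f = u \<otimes> x \<oplus> v \<otimes> y"
    using *(8) carr' by simp
  moreover have "u \<otimes> x \<oplus> v \<otimes> y \<in> E"
    using *(4,5) assms(3,4) by (intro E_add E_smult)
  ultimately have "f \<in> E" by metis
  moreover have "a' \<in> E" "b' \<in> E" "u \<in> E" "v \<in> E"
    using *(1,2,4,5) assms(2) by auto
  ultimately show ?thesis
    using x y *(8) by blast
qed

lemma bezout_imp_hermite_dup:
  assumes "bezout_ring (K\<lparr>carrier := A\<rparr>)" "A \<subseteq> E"
  shows "hermite_ring dup"
proof -
  have "(a, x) \<in> carrier dup \<longleftrightarrow> a \<in> A \<and> x \<in> E" for a x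
  proof (cases "a \<in> A \<and> x \<in> carrier K")
    case True
    then have a: "a \<in> E" "a \<in> carrier K"
      using assms A_sub by auto
    \<comment> \<open>Since \<open>a\<close> itself lies in \<open>E\<close>, the difference
      \<open>x - a\<close> lies in \<open>E\<close> exactly when \<open>x\<close> does.\<close>
    have "x = (x \<ominus> a) \<oplus> a" "x \<ominus> a = x \<oplus> \<ominus> a"
      using True a by algebra+
    then show ?thesis
      using True a E_add E_neg unfolding in_dup_iff by metis
  next
    case False
    then show ?thesis
      using E_sub unfolding in_dup_iff by blast
  qed
  then have carrier: "carrier dup = A \<times> E"
    by auto
  have "unimodular_factorization dup"
  proof (intro unimodular_factorization.intro unimodular_factorization_axioms.intro dup_cring)
    fix r s assume "r \<in> carrier dup" "s \<in> carrier dup"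
    then obtain a x b y where rs: "r = (a, x)" "s = (b, y)" "a \<in> A" "b \<in> A" "x \<in> E" "y \<in> E"
      unfolding carrier by blast
    obtain a' b' d u v where A: "a' \<in> A" "b' \<in> A" "d \<in> A" "u \<in> A" "v \<in> A"
        "a = a' \<otimes> d" "b = b' \<otimes> d" "u \<otimes> a' \<oplus> v \<otimes> b' = \<one>"
      using unimodular_factors_in_A [OF assms(1) rs(3,4)] .
    obtain x' y' f w z where E: "x' \<in> E" "y' \<in> E" "f \<in> E" "w \<in> E" "z \<in> E"
        "x = x' \<otimes> f" "y = y' \<otimes> f" "w \<otimes> x' \<oplus> z \<otimes> y' = \<one>"
      using overring_unimodular_factors [OF assms rs(5,6)] by (elim bexE conjE)
    show "\<exists>a' \<in> carrier dup. \<exists>b' \<in> carrier dup. \<exists>d \<in> carrier dup. \<exists>u \<in> carrier dup.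
        \<exists>v \<in> carrier dup. r = a' \<otimes>\<^bsub>dup\<^esub> d \<and> s = b' \<otimes>\<^bsub>dup\<^esub> d \<and>
          u \<otimes>\<^bsub>dup\<^esub> a' \<oplus>\<^bsub>dup\<^esub> v \<otimes>\<^bsub>dup\<^esub> b' = \<one>\<^bsub>dup\<^esub>"
      \<comment> \<open>The carrier is now a full product, so the factorizations in \<open>A\<close>
        and in \<open>E\<close> can be paired without any compatibility between them.\<close>
      unfolding carrier rs(1,2)
      by (rule bexI [of _ "(a', x')"], rule bexI [of _ "(b', y')"], rule bexI [of _ "(d, f)"],
          rule bexI [of _ "(u, w)"], rule bexI [of _ "(v, z)"]) (simp_all add: A E)
  qed
  then show ?thesis
    by (rule unimodular_factorization.hermite_ring)
qed

end

theorem corollary2p11: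
  fixes K :: "('a, 'm) ring_scheme" and A E :: "'a set"
  assumes "quotient_field_of A K"
    and "submodule E (K\<lparr>carrier := A\<rparr>) (self_module K)"
    and "E \<noteq> {\<zero>\<^bsub>K\<^esub>}"
    and "\<forall>x \<in> E. \<forall>y \<in> E. x \<otimes>\<^bsub>K\<^esub> y \<in> E"
  shows "(hermite_ring (amalgamated_duplication K A E) \<longleftrightarrow>
            bezout_ring (amalgamated_duplication K A E)) \<and>
         (bezout_ring (amalgamated_duplication K A E) \<longleftrightarrow>
            bezout_ring (K\<lparr>carrier := A\<rparr>) \<and> A \<subseteq> E)"
proof -
  interpret duplication_data K A E
    using assms by (intro duplication_data.intro) blast+
  \<comment> \<open>The implications form a cycle: Hermite to Bezout, Bezout to the conditions on
    \<open>A\<close> and \<open>E\<close>, and from these back to Hermite.\<close>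
  show ?thesis
    using hermite_imp_bezout [of dup] bezout_dup_imp_bezout bezout_dup_imp_subset bezout_imp_hermite_dup
    by argo
qed

end
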